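(* Let $F,Q\in\mathbb{R}^{cn\times cn}$, $H\in\mathbb{R}^{dn\times cn}$, $R\in\mathbb{R}^{dn\times dn}$ be fixed matrices, where $F,H,R$ are block diagonal with $n$ diagonal blocks $F^{(i)}\in\mathbb{R}^{c\times c}$, $H^{(i)}\in\mathbb{R}^{d\times c}$, $R^{(i)}\in\mathbb{R}^{d\times d}$ ($i=1,\dots,n$), $R$ is symmetric positive definite, and $Q$ is symmetric. If the pair $[F,H]$ is detectable and $Q>0$, then for every symmetric positive-definite initial matrix $\tilde P_{0|0}>0$, the sequence $\tilde P_{k|k-1}$ generated by the (time-invariant) block-diagonal filter recursion $$\tilde P_{k|k-1}=F\tilde P_{k-1|k-1}F^{T}+Q,\qquad \tilde K_k=\tilde P_{k|k-1}H^{T}\left(H\tilde P_{k|k-1}H^{T}+R\right)^{-1},\qquad \tilde P_{k|k}=\mathcal{D}\left\{(I-\tilde K_kH)\tilde P_{k|k-1}\right\},\qquad k\ge 1,$$ converges as $k\to\infty$ to the unique positive-definite solution $\tilde P_{-}$ of $$\tilde P_{-}=F\,\mathcal{D}\left\{\tilde P_{-}-\tilde P_{-}H^{T}\left(H\tilde P_{-}H^{T}+R\right)^{-1}H\tilde P_{-}\right\}F^{T}+Q .$$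
   Context: $\mathcal{D}$ is the linear projection on $cn\times cn$ matrices that keeps the $n$ diagonal blocks of size $c\times c$ and replaces all off-diagonal blocks by zero: if $M=[M_{i,j}]_{i,j=1}^n$ with $M_{i,j}\in\mathbb{R}^{c\times c}$, then $\mathcal{D}\{M\}$ is block diagonal with diagonal blocks $M_{i,i}$. For symmetric matrices, $A>0$ means $A$ is positive definite. The pair $[F,H]$ is detectable if there is a matrix $L$ such that all eigenvalues of $F-LH$ lie strictly inside the unit circle. In the underlying model, $n$ linear sub-systems $x^{(i)}_{k+1}=F^{(i)}x^{(i)}_k+v^{(i)}_k+G^{(i)}u_k$, $y^{(i)}_k=H^{(i)}x^{(i)}_k+w^{(i)}_k$ are coupled only by the common random input $u_k\in\mathbb{R}^r$ with covariance $U$, the noises $v^{(i)}_k$, $w^{(i)}_k$ have covariances $V^{(i)}$, $R^{(i)}$, and $Q$ is the total process noise covariance $Q=V+GUG^T$ (with $V$ block diagonal and $G$ the stacking of the $G^{(i)}$), so $Q$ need not be block diagonal. *)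

theory Defs
  imports "HOL-Analysis.Analysis"
begin

text \<open>
  A \<open>pn \<times> qn\<close> matrix made of \<open>n \<times> n\<close> blocks of size \<open>p \<times> q\<close> has type
  \<open>real ^ ('n \<times> 'q) ^ ('n \<times> 'p)\<close>: the index \<open>(i, a)\<close> is position \<open>a\<close> inside the \<open>i\<close>-th block.
\<close>

definition block :: "real ^ ('n::finite \<times> 'q::finite) ^ ('n \<times> 'p::finite) \<Rightarrow> 'n \<Rightarrow> 'n \<Rightarrow> real ^ 'q ^ 'p"
  where "block M i j = (\<chi> a b. M $ (i, a) $ (j, b))"

definition block_diag :: "('n::finite \<Rightarrow> real ^ 'q::finite ^ 'p::finite) \<Rightarrow> real ^ ('n \<times> 'q) ^ ('n \<times> 'p)"
  where "block_diag B = (\<chi> r s. if fst r = fst s then B (fst r) $ snd r $ snd s else 0)"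

text \<open>The projection \<open>\<D>\<close>.\<close>

definition block_diag_proj ::
    "real ^ ('n::finite \<times> 'c::finite) ^ ('n \<times> 'c) \<Rightarrow> real ^ ('n \<times> 'c) ^ ('n \<times> 'c)"
  where "block_diag_proj M = block_diag (\<lambda>i. block M i i)"

definition pos_def :: "real ^ 'm::finite ^ 'm \<Rightarrow> bool"
  where "pos_def A \<longleftrightarrow> transpose A = A \<and> (\<forall>x. x \<noteq> 0 \<longrightarrow> x \<bullet> (A *v x) > 0)"

definition eigenvalue :: "complex ^ 'm::finite ^ 'm \<Rightarrow> complex \<Rightarrow> bool"
  where "eigenvalue A z \<longleftrightarrow> (\<exists>v. v \<noteq> 0 \<and> A *v v = z *s v)"

text \<open>The gain \<open>L\<close> ranges over all real matrices; it is not required to be block diagonal.\<close>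

definition detectable :: "real ^ 'm::finite ^ 'm \<Rightarrow> real ^ 'm ^ 'k::finite \<Rightarrow> bool"
  where "detectable F H \<longleftrightarrow>
    (\<exists>L :: real ^ 'k ^ 'm. \<forall>z. eigenvalue (map_matrix complex_of_real (F - L ** H)) z \<longrightarrow> cmod z < 1)"

text \<open>
  \<open>Pm k\<close>, \<open>K k\<close>, \<open>Pp k\<close> stand for \<open>P\<^bsub>k|k-1\<^esub>\<close>, \<open>K\<^sub>k\<close>, \<open>P\<^bsub>k|k\<^esub>\<close>. The initial matrix is \<open>Pp 0\<close>;
  the recursion starts at \<open>k = 1\<close>, so \<open>Pm 0\<close> and \<open>K 0\<close> are irrelevant.
\<close>

definition block_diag_filter ::
    "real ^ ('n::finite \<times> 'c::finite) ^ ('n \<times> 'c) \<Rightarrow> real ^ ('n \<times> 'c) ^ ('n \<times> 'c) \<Rightarrow>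
     real ^ ('n \<times> 'c) ^ ('n \<times> 'd::finite) \<Rightarrow> real ^ ('n \<times> 'd) ^ ('n \<times> 'd) \<Rightarrow>
     (nat \<Rightarrow> real ^ ('n \<times> 'c) ^ ('n \<times> 'c)) \<Rightarrow> (nat \<Rightarrow> real ^ ('n \<times> 'd) ^ ('n \<times> 'c)) \<Rightarrow>
     (nat \<Rightarrow> real ^ ('n \<times> 'c) ^ ('n \<times> 'c)) \<Rightarrow> bool"
  where "block_diag_filter F Q H R Pm K Pp \<longleftrightarrow>
    (\<forall>k\<ge>1. Pm k = F ** Pp (k - 1) ** transpose F + Q \<and>
           K k = Pm k ** transpose H ** matrix_inv (H ** Pm k ** transpose H + R) \<and>
           Pp k = block_diag_proj ((mat 1 - K k ** H) ** Pm k))"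

definition steady_state ::
    "real ^ ('n::finite \<times> 'c::finite) ^ ('n \<times> 'c) \<Rightarrow> real ^ ('n \<times> 'c) ^ ('n \<times> 'c) \<Rightarrow>
     real ^ ('n \<times> 'c) ^ ('n \<times> 'd::finite) \<Rightarrow> real ^ ('n \<times> 'd) ^ ('n \<times> 'd) \<Rightarrow>
     real ^ ('n \<times> 'c) ^ ('n \<times> 'c) \<Rightarrow> bool"
  where "steady_state F Q H R P \<longleftrightarrow>
    P = F ** block_diag_proj
              (P - P ** transpose H ** matrix_inv (H ** P ** transpose H + R) ** H ** P)
          ** transpose F + Q"

end

theory Submission
  imports Defs "HOL-Computational_Algebra.Fundamental_Theorem_Algebra"
begin

text \<open>
  Write \<open>h\<close> for the map that takes one predicted covariance to the next, and order symmetric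
  matrices by their quadratic forms. The theorem follows from order properties of \<open>h\<close> alone.

  The measurement update is a minimum over all linear estimators of the error variance, which is
  affine in \<open>P\<close> and has the noise term \<open>R\<close> (\<open>update_cost_complete_square\<close>). Hence the update is
  monotone, and scaling \<open>P\<close> by \<open>t \<le> 1\<close> scales it by at least \<open>t\<close>. The block projection preserves
  the order, because its form at \<open>x\<close> is the sum of the original form over the block parts of \<open>x\<close>.
  Therefore \<open>h\<close> is monotone and \<open>h(t P) \<ge> t h(P) + (1 - t) Q\<close> for \<open>0 < t \<le> 1\<close>, with the reverse
  inequality for \<open>t \<ge> 1\<close>.

  If \<open>P\<close> is a positive definite fixed point, then \<open>Q \<ge> e P\<close> for some \<open>e > 0\<close>, and these
  inequalities say that \<open>t P \<le> X \<le> s P\<close> improves under \<open>h\<close>: the gaps \<open>1 - t\<close> and \<open>s - 1\<close> shrink by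
  the factor \<open>1 - e\<close>. So every positive definite starting point is attracted to \<open>P\<close>
  (\<open>riccati_iterates_tendsto_fixed_point\<close>), and uniqueness is the special case of a start at
  another fixed point.

  A fixed point arises as the limit of the increasing sequence \<open>Q, h(Q), h(h(Q)), \<dots>\<close>, as soon as
  this is bounded. Boundedness is where detectability and the block structure of \<open>F\<close>, \<open>H\<close>, \<open>R\<close>
  enter (\<open>riccati_iterates_bounded\<close>): after enlarging \<open>Q\<close> to a multiple of the identity, all
  matrices are block diagonal, the projection loses nothing, and a stabilizing gain \<open>L\<close> yields a
  bound as for the ordinary Kalman filter. That bound needs a power of \<open>(F - L H)\<^sup>T\<close> which is a
  contraction (\<open>transpose_power_contraction\<close>); it is obtained from the eigenvalue condition by
  splitting annihilating polynomials into linear factors.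
\<close>

(* The adjoint is kept as a matrix acting from the left, so that it composes with its powers. *)
declare transpose_matrix_vector [simp del]

section \<open>Powers of a matrix with spectrum in the open unit disc\<close>

definition poly_apply :: "complex ^ 'm::finite ^ 'm \<Rightarrow> complex poly \<Rightarrow> complex ^ 'm \<Rightarrow> complex ^ 'm"
  where "poly_apply A p w = (\<Sum>i\<le>degree p. coeff p i *s (((*v) A ^^ i) w))"

lemma poly_apply_upto:
  assumes "degree p \<le> n"
  shows "poly_apply A p w = (\<Sum>i\<le>n. coeff p i *s (((*v) A ^^ i) w))"
  unfolding poly_apply_def
  by (rule sum.mono_neutral_left) (use assms in \<open>auto simp: coeff_eq_0\<close>)

lemma funpow_mult_add: "((*v) (A :: 'a::field ^ 'm::finite ^ 'm) ^^ k) (v + w) = ((*v) A ^^ k) v + ((*v) A ^^ k) w"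
  by (induction k) (auto simp: matrix_vector_right_distrib)

lemma funpow_mult_diff: "((*v) (A :: 'a::field ^ 'm::finite ^ 'm) ^^ k) (v - w) = ((*v) A ^^ k) v - ((*v) A ^^ k) w"
  by (induction k) (auto simp: matrix_vector_mult_diff_distrib)

lemma funpow_mult_scale: "((*v) (A :: 'a::field ^ 'm::finite ^ 'm) ^^ k) (c *s v) = c *s ((*v) A ^^ k) v"
  by (induction k) (auto simp: vector_scalar_commute)

text \<open>
  Both rules express that \<open>(X - z) q\<close> acts as the composition of \<open>A - z\<close> and \<open>q(A)\<close>, in either
  order: the first exposes an eigenvector of \<open>A\<close>, the second shortens the polynomial.
\<close>

lemma poly_apply_linear_factor:
  "poly_apply A ([:-z, 1:] * q) w = A *v poly_apply A q w - z *s poly_apply A q w"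
  "poly_apply A ([:-z, 1:] * q) w = poly_apply A q (A *v w - z *s w)"
proof -
  let ?n = "degree q"
  let ?c = "\<lambda>i. coeff q i *s ((*v) A ^^ i) w"
  let ?d = "\<lambda>i. coeff q i *s (A *v (((*v) A ^^ i) w))"
  have eq: "[:-z, 1:] * q = pCons 0 q + smult (- z) q" by simp
  have "degree ([:-z, 1:] * q) \<le> Suc ?n"
    by (rule order_trans[OF degree_mult_le]) simp
  then have "poly_apply A ([:-z, 1:] * q) w
      = (\<Sum>i\<le>Suc ?n. coeff (pCons 0 q) i *s ((*v) A ^^ i) w) - (\<Sum>i\<le>Suc ?n. z *s ?c i)"
    unfolding eq by (subst poly_apply_upto[of _ "Suc ?n"])
      (simp_all only: coeff_add coeff_smult vec.scale_left_distrib sum.distrib sum_negf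
        vec.scale_scale mult_minus_left vec.scale_minus_left diff_conv_add_uminus)
  also have "(\<Sum>i\<le>Suc ?n. coeff (pCons 0 q) i *s ((*v) A ^^ i) w) = sum ?d {..?n}"
    by (subst sum.atMost_Suc_shift) simp
  also have "(\<Sum>i\<le>Suc ?n. z *s ?c i) = (\<Sum>i\<le>?n. z *s ?c i)"
    by (simp add: coeff_eq_0)
  finally have main: "poly_apply A ([:-z, 1:] * q) w = sum ?d {..?n} - (\<Sum>i\<le>?n. z *s ?c i)" .
  show "poly_apply A ([:-z, 1:] * q) w = A *v poly_apply A q w - z *s poly_apply A q w"
    unfolding main unfolding poly_apply_def
    by (simp add: vec.scale_sum_right matrix_vector_right_distrib[symmetric] vec.linear_sum[OF matrix_vector_mul_linear_gen]
        vector_scalar_commute)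
  show "poly_apply A ([:-z, 1:] * q) w = poly_apply A q (A *v w - z *s w)"
    unfolding main unfolding poly_apply_def
    by (simp add: funpow_mult_diff funpow_mult_scale funpow_swap1 vec.scale_right_diff_distrib
        sum_subtractf mult.commute)
qed

text \<open>
  The orbit of \<open>w\<close> under \<open>A\<close> lies in a finite-dimensional space, so its first members are
  linearly dependent. The orbit may also repeat itself, which a set
  of vectors cannot record as a dependence, so that case is treated apart.
\<close>

lemma annihilating_polynomial_exists:
  fixes A :: "complex ^ 'm::finite ^ 'm"
  obtains p where "p \<noteq> 0" "poly_apply A p w = 0"
proof -
  let ?N = "DIM(complex ^ 'm)"
  let ?f = "\<lambda>i. ((*v) A ^^ i) w"
  show thesis
  proof (cases "inj_on ?f {..?N}")
    case True
    then have "card (?f ` {..?N}) = Suc ?N" by (simp add: card_image)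
    then have "dependent (?f ` {..?N})" by (intro dependent_biggerset) auto
    then obtain u i0 where i0: "i0 \<le> ?N" "u (?f i0) \<noteq> 0"
      and sum0: "(\<Sum>v\<in>?f ` {..?N}. u v *\<^sub>R v) = 0"
      by (auto simp: dependent_finite)
    define p where "p = (\<Sum>i\<le>?N. monom (complex_of_real (u (?f i))) i)"
    have coeff: "coeff p i = (if i \<le> ?N then complex_of_real (u (?f i)) else 0)" for i
      by (simp add: p_def coeff_sum)
    have "degree p \<le> ?N"
      by (rule degree_le) (simp add: coeff)
    then have "poly_apply A p w = (\<Sum>i\<le>?N. coeff p i *s ?f i)" by (rule poly_apply_upto)
    also have "\<dots> = (\<Sum>i\<le>?N. u (?f i) *\<^sub>R ?f i)"
      by (rule sum.cong) (auto simp: coeff vec_eq_iff scaleR_conv_of_real[where 'a = complex])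
    also have "\<dots> = 0" using sum0 unfolding sum.reindex[OF True] by (simp only: o_def)
    finally have "poly_apply A p w = 0" .
    moreover have "p \<noteq> 0" using coeff[of i0] i0 by auto
    ultimately show ?thesis using that by blast
  next
    case False
    then obtain i j where ij: "i \<noteq> j" "?f i = ?f j" by (auto simp: inj_on_def)
    define p where "p = monom (1::complex) i - monom 1 j"
    have "coeff p i = 1" using ij by (simp add: p_def)
    then have "p \<noteq> 0" by auto
    have "degree p \<le> i + j"
      unfolding p_def by (rule degree_diff_le) (auto intro: order_trans[OF degree_monom_le])
    then have "poly_apply A p w = (\<Sum>k\<le>i+j. coeff p k *s ?f k)" by (rule poly_apply_upto)
    also have "\<dots> = (\<Sum>k\<le>i+j. (if k = i then ?f i else 0) - (if k = j then ?f j else 0))"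
      by (rule sum.cong) (auto simp: p_def)
    also have "\<dots> = 0" using ij by (simp add: sum_subtractf)
    finally show ?thesis using that \<open>p \<noteq> 0\<close> by blast
  qed
qed

text \<open>
  Once \<open>e\<close> stays below \<open>(1 - a) r / 2\<close>, the recursion contracts towards the ball of radius
  \<open>r / 2\<close>.
\<close>

lemma perturbed_contraction_tendsto_0:
  fixes x :: "nat \<Rightarrow> 'a::real_normed_vector"
  assumes step: "\<And>k. norm (x (Suc k)) \<le> a * norm (x k) + e k"
    and "0 \<le> a" "a < 1" "e \<longlonglongrightarrow> 0"
  shows "x \<longlonglongrightarrow> 0"
proof (rule tendsto_norm_zero_cancel, rule LIMSEQ_I)
  fix r :: real assume "0 < r"
  define d where "d = (1 - a) * (r / 2)"
  have "d > 0" using \<open>0 < r\<close> \<open>a < 1\<close> by (simp add: d_def)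
  then obtain N where N: "\<And>k. k \<ge> N \<Longrightarrow> norm (e k) < d"
    using LIMSEQ_D[OF \<open>e \<longlonglongrightarrow> 0\<close>] by force
  have bound: "norm (x (N + k)) \<le> r / 2 + a ^ k * norm (x N)" for k
  proof (induction k)
    case 0 then show ?case using \<open>0 < r\<close> by simp
  next
    case (Suc k)
    have "norm (x (N + Suc k)) \<le> a * norm (x (N + k)) + e (N + k)" using step[of "N + k"] by simp
    also have "\<dots> \<le> a * (r / 2 + a ^ k * norm (x N)) + d"
      using Suc \<open>0 \<le> a\<close> N[of "N + k"] by (intro add_mono mult_left_mono) auto
    also have "\<dots> = r / 2 + a ^ Suc k * norm (x N)" by (simp add: d_def field_simps)
    finally show ?case .
  qed
  have "(\<lambda>k. a ^ k * norm (x N)) \<longlonglongrightarrow> 0"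
    using assms by (intro tendsto_mult_left_zero LIMSEQ_power_zero) auto
  then obtain M where M: "\<And>k. k \<ge> M \<Longrightarrow> norm (a ^ k * norm (x N)) < r / 2"
    using LIMSEQ_D[of _ 0 "r / 2"] \<open>0 < r\<close> by force
  have "norm (norm (x n) - 0) < r" if "n \<ge> N + M" for n
  proof -
    have "norm (x n) \<le> r / 2 + a ^ (n - N) * norm (x N)" using bound[of "n - N"] that by simp
    moreover have "\<bar>a ^ (n - N) * norm (x N)\<bar> < r / 2" using M[of "n - N"] that by simp
    ultimately show ?thesis by simp
  qed
  then show "\<exists>no. \<forall>n\<ge>no. norm (norm (x n) - 0) < r" by blast
qed

lemma norm_complex_scale: "norm (z *s (v :: complex ^ 'm::finite)) = cmod z * norm v"
  by (simp add: norm_vec_def norm_mult L2_set_right_distrib)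

text \<open>
  Induction on the degree of a polynomial \<open>p\<close> that annihilates \<open>w\<close>, which replaces the Jordan
  form. Split off a root \<open>z\<close>, \<open>p = (X - z) q\<close>. If \<open>\<bar>z\<bar> < 1\<close>, then \<open>q\<close> annihilates
  \<open>A w - z w\<close>, whose orbit therefore vanishes in the limit, and the orbit of \<open>w\<close> satisfies a
  contractive scalar recursion driven by it. Otherwise \<open>z\<close> is not an eigenvalue, and
  \<open>(A - z) q(A) w = 0\<close> forces \<open>q(A) w = 0\<close>.
\<close>

lemma powers_tendsto_0_complex:
  fixes A :: "complex ^ 'm::finite ^ 'm"
  assumes eig: "\<And>z. eigenvalue A z \<Longrightarrow> cmod z < 1"
  shows "(\<lambda>k. ((*v) A ^^ k) w) \<longlonglongrightarrow> 0"
proof -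
  have "(\<lambda>k. ((*v) A ^^ k) w) \<longlonglongrightarrow> 0" if "p \<noteq> 0" "poly_apply A p w = 0" for p w
    using that
  proof (induction "degree p" arbitrary: p w)
    case 0
    then obtain c where "p = [:c:]" by (metis degree_0_id)
    with 0 have "w = 0" by (simp add: poly_apply_def)
    then have "((*v) A ^^ k) w = 0" for k by (induction k) auto
    then show ?case by simp
  next
    case (Suc n)
    then obtain z where "poly p z = 0"
      using fundamental_theorem_of_algebra[of p] by (auto simp: constant_degree)
    then obtain q where p: "p = [:-z, 1:] * q" by (auto simp: poly_eq_0_iff_dvd dvd_def)
    with Suc.prems have "q \<noteq> 0" by auto
    then have deg: "n = degree q" using Suc.hyps(2) unfolding p by (subst (asm) degree_mult_eq) auto
    show ?case
    proof (cases "cmod z < 1")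
      case True
      let ?v = "A *v w - z *s w"
      have "poly_apply A q ?v = 0"
        using Suc.prems(2) poly_apply_linear_factor(2) unfolding p by metis
      then have v: "(\<lambda>k. ((*v) A ^^ k) ?v) \<longlonglongrightarrow> 0" using Suc.hyps(1)[OF deg \<open>q \<noteq> 0\<close>] by blast
      have "((*v) A ^^ Suc k) w = z *s ((*v) A ^^ k) w + ((*v) A ^^ k) ?v" for k
        by (simp add: funpow_mult_diff funpow_mult_scale funpow_swap1)
      then have "norm (((*v) A ^^ Suc k) w) \<le> cmod z * norm (((*v) A ^^ k) w) + norm (((*v) A ^^ k) ?v)" for k
        by (metis norm_triangle_ineq norm_complex_scale)
      then show ?thesis
        by (rule perturbed_contraction_tendsto_0[OF _ norm_ge_zero True tendsto_norm_zero[OF v]])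
    next
      case False
      have "A *v poly_apply A q w = z *s poly_apply A q w"
        using Suc.prems(2) poly_apply_linear_factor(1)[of A z q w] unfolding p by simp
      then have "poly_apply A q w = 0" using eig[of z] False unfolding eigenvalue_def by blast
      then show ?thesis using Suc.hyps(1)[OF deg \<open>q \<noteq> 0\<close>] by blast
    qed
  qed
  then show ?thesis using annihilating_polynomial_exists by metis
qed

lemma powers_tendsto_0:
  fixes A :: "real ^ 'm::finite ^ 'm"
  assumes eig: "\<And>z. eigenvalue (map_matrix complex_of_real A) z \<Longrightarrow> cmod z < 1"
  shows "(\<lambda>k. ((*v) A ^^ k) w) \<longlonglongrightarrow> 0"
proof -
  let ?c = "\<lambda>v :: real ^ 'm. \<chi> i. complex_of_real (v $ i)"
  have step: "map_matrix complex_of_real A *v ?c v = ?c (A *v v)" for v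
    by (simp add: vec_eq_iff matrix_vector_mult_def map_matrix_def)
  have *: "((*v) (map_matrix complex_of_real A) ^^ k) (?c w) = ?c (((*v) A ^^ k) w)" for k
    by (induction k) (simp_all add: step)
  have lim: "(\<lambda>k. ?c (((*v) A ^^ k) w)) \<longlonglongrightarrow> 0"
    using powers_tendsto_0_complex[of "map_matrix complex_of_real A" "?c w", OF eig]
    unfolding * .
  have "(\<lambda>k. (((*v) A ^^ k) w) $ i) \<longlonglongrightarrow> 0" for i
    using tendsto_vec_nth[OF lim, of i] by (simp flip: tendsto_of_real_iff[where 'a=complex])
  then show ?thesis by (intro vec_tendstoI) simp
qed

lemma inner_matrix_transpose: "x \<bullet> (A *v y) = (transpose A *v x) \<bullet> y"
  for A :: "real ^ 'm::finite ^ 'k::finite"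
  by (simp add: dot_lmul_matrix transpose_matrix_vector)

text \<open>
  Orbits of the transpose vanish because their inner products with fixed vectors are inner
  products with orbits of \<open>A\<close>. Convergence on the finitely many unit vectors is uniform, which
  gives one power that contracts all vectors.
\<close>

lemma transpose_power_contraction:
  fixes A :: "real ^ 'm::finite ^ 'm"
  assumes eig: "\<And>z. eigenvalue (map_matrix complex_of_real A) z \<Longrightarrow> cmod z < 1"
  obtains m where "m > 0" "\<And>x. (norm (((*v) (transpose A) ^^ m) x))\<^sup>2 \<le> (norm x)\<^sup>2 / 2"
proof -
  let ?B = "\<lambda>k. (*v) (transpose A) ^^ k"
  have inner: "?B k x \<bullet> w = x \<bullet> ((*v) A ^^ k) w" for k x w
    by (induction k arbitrary: w)
      (simp_all add: inner_matrix_transpose[symmetric] funpow_swap1[of "(*v) A"])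
  have lim: "(\<lambda>k. ?B k x) \<longlonglongrightarrow> 0" for x
  proof (rule vec_tendstoI)
    fix i
    have "(\<lambda>k. x \<bullet> ((*v) A ^^ k) (axis i 1)) \<longlonglongrightarrow> x \<bullet> 0"
      by (intro tendsto_intros powers_tendsto_0 eig)
    then show "(\<lambda>k. ?B k x $ i) \<longlonglongrightarrow> 0 $ i"
      by (simp add: inner[symmetric] inner_axis)
  qed
  have "(\<lambda>k. \<Sum>i\<in>UNIV. norm (?B k (axis i 1))) \<longlonglongrightarrow> 0"
    by (intro tendsto_null_sum tendsto_norm_zero lim)
  then have "\<forall>\<^sub>F k in sequentially. (\<Sum>i\<in>UNIV. norm (?B k (axis i 1))) < 1 / 2"
    by (rule order_tendstoD) simp
  then obtain m0 where m0: "\<And>k. k \<ge> m0 \<Longrightarrow> (\<Sum>i\<in>UNIV. norm (?B k (axis i 1))) < 1 / 2"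
    by (auto simp: eventually_sequentially)
  \<comment> \<open>A positive exponent, so that the sum of the squares over all smaller powers contains that of x itself.\<close>
  define m where "m = Suc m0"
  have small: "(\<Sum>i\<in>UNIV. norm (?B m (axis i 1))) < 1 / 2" using m0[of m] by (simp add: m_def)
  have "(norm (?B m x))\<^sup>2 \<le> (norm x)\<^sup>2 / 2" for x
  proof -
    have sum: "?B m (\<Sum>i\<in>I. f i) = (\<Sum>i\<in>I. ?B m (f i))" if "finite I" for I and f :: "'m \<Rightarrow> _"
      using that
    proof (induction I)
      case empty
      have "?B k 0 = 0" for k by (induction k) auto
      then show ?case by simp
    qed (simp add: funpow_mult_add)
    have "?B m x = ?B m (\<Sum>i\<in>UNIV. x $ i *s axis i 1)" by (simp add: basis_expansion)
    also have "\<dots> = (\<Sum>i\<in>UNIV. x $ i *s ?B m (axis i 1))" by (simp add: sum funpow_mult_scale)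
    finally have "norm (?B m x) \<le> (\<Sum>i\<in>UNIV. norm (x $ i *s ?B m (axis i 1)))"
      by (simp add: norm_sum)
    also have "\<dots> \<le> (\<Sum>i\<in>UNIV. norm x * norm (?B m (axis i 1)))"
      by (intro sum_mono) (simp add: scalar_mult_eq_scaleR mult_right_mono component_le_norm_cart)
    also have "\<dots> \<le> norm x * (1 / 2)"
      unfolding sum_distrib_left[symmetric] using small by (intro mult_left_mono) auto
    finally have "(norm (?B m x))\<^sup>2 \<le> (norm x * (1 / 2))\<^sup>2" by (rule power_mono) simp
    also have "\<dots> \<le> (norm x)\<^sup>2 / 2" by (simp add: power_mult_distrib power2_eq_square)
    finally show ?thesis .
  qed
  then show thesis using that[of m] by (simp add: m_def)
qed

section \<open>Quadratic forms of real matrices\<close>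

definition qform :: "real ^ 'm::finite ^ 'm \<Rightarrow> real ^ 'm \<Rightarrow> real"
  where "qform M x = x \<bullet> (M *v x)"

lemma qform_add: "qform (M + N) x = qform M x + qform N x"
  by (simp add: qform_def matrix_vector_mult_add_rdistrib inner_add_right)

lemma qform_diff: "qform (M - N) x = qform M x - qform N x"
  by (simp add: qform_def matrix_vector_mult_diff_rdistrib inner_diff_right)

lemma qform_scaleR: "qform (t *\<^sub>R M) x = t * qform M x"
  by (simp add: qform_def scaleR_matrix_vector_assoc[symmetric])

lemma qform_mat: "qform (mat q) x = q * (norm x)\<^sup>2"
proof -
  have "mat q *v x = q *\<^sub>R x" 
    by (simp add: vec_eq_iff matrix_vector_mult_def mat_def if_distrib[of "\<lambda>a. a * _"] cong: if_cong)
  then show ?thesis by (simp add: qform_def dot_square_norm)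
qed

lemma qform_congruence: "qform (A ** M ** transpose A) x = qform M (transpose A *v x)"
  unfolding qform_def by (simp only: matrix_vector_mul_assoc[symmetric] inner_matrix_transpose[of x A])

lemma symmetric_inner_commute:
  fixes M :: "real ^ 'm::finite ^ 'm"
  assumes "transpose M = M" shows "x \<bullet> (M *v y) = y \<bullet> (M *v x)"
  using inner_matrix_transpose[of x M y] unfolding assms by (simp only: inner_commute)

lemma transpose_add: "transpose (A + B) = transpose A + transpose B"
  and transpose_diff: "transpose (A - B) = transpose A - transpose B"
  for A B :: "real ^ 'm::finite ^ 'k::finite"
  by (simp_all add: vec_eq_iff transpose_def)

lemma symmetric_congruence:
  fixes A :: "real ^ 'm::finite ^ 'k::finite"
  assumes "transpose M = M" shows "transpose (A ** M ** transpose A) = A ** M ** transpose A"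
  by (simp add: matrix_transpose_mul matrix_mul_assoc assms)

lemma symmetric_entries:
  assumes "transpose M = M" shows "M $ i $ j = M $ j $ i"
proof -
  have "transpose M $ j $ i = M $ i $ j" by (simp add: transpose_def)
  then show ?thesis unfolding assms by simp
qed

lemma polarization:
  assumes "transpose M = M"
  shows "M $ i $ j = (qform M (axis i 1 + axis j 1) - qform M (axis i 1) - qform M (axis j 1)) / 2"
proof -
  have "axis i 1 \<bullet> (M *v axis j 1) = M $ i $ j" for i j
    by (simp add: inner_axis' matrix_vector_mul_component inner_axis)
  moreover have "M $ j $ i = M $ i $ j" by (rule symmetric_entries[OF assms])
  ultimately show ?thesis
    by (simp add: qform_def matrix_vector_right_distrib inner_add_left inner_add_right)
qed

lemma symmetric_eq_if_qform_eq:
  assumes "transpose M = M" "transpose N = N" "\<And>x. qform M x = qform N x"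
  shows "M = N"
  unfolding vec_eq_iff polarization[OF assms(1)] polarization[OF assms(2)] assms(3) by simp

text \<open>
  By polarization, entries of symmetric matrices are linear in finitely many values of the
  form, so all limits can be taken on the level of forms, where monotone convergence and
  sandwiching are available.
\<close>

lemma tendsto_matrix_if_qform_tendsto:
  assumes "\<And>k. transpose (X k) = X k" "transpose P = P"
    and "\<And>x. (\<lambda>k. qform (X k) x) \<longlonglongrightarrow> qform P x"
  shows "X \<longlonglongrightarrow> P"
proof (intro vec_tendstoI)
  fix i j
  show "(\<lambda>k. X k $ i $ j) \<longlonglongrightarrow> P $ i $ j"
    unfolding polarization[OF assms(1)] polarization[OF assms(2)]
    by (intro tendsto_intros assms(3)) simp
qed

lemma symmetric_limit_if_qform_convergent:
  assumes sym: "\<And>k. transpose (X k) = X k"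
    and conv: "\<And>x. convergent (\<lambda>k. qform (X k) x)"
  obtains P where "transpose P = P" "X \<longlonglongrightarrow> P"
proof -
  define P where "P = (\<chi> i j. lim (\<lambda>k. X k $ i $ j))"
  have entry: "(\<lambda>k. X k $ i $ j) \<longlonglongrightarrow> P $ i $ j" for i j
  proof -
    note lims = conv[THEN convergent_LIMSEQ_iff[THEN iffD1]]
    have "convergent (\<lambda>k. X k $ i $ j)"
      unfolding polarization[OF sym]
      by (rule convergentI, rule tendsto_divide[OF tendsto_diff[OF tendsto_diff[OF lims lims] lims] tendsto_const])
        simp
    then show ?thesis by (simp add: P_def convergent_LIMSEQ_iff)
  qed
  have "P $ j $ i = P $ i $ j" for i j
    unfolding P_def by (simp add: symmetric_entries[OF sym, of _ j i])
  then have "transpose P = P" by (simp add: vec_eq_iff transpose_def)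
  moreover have "X \<longlonglongrightarrow> P" by (intro vec_tendstoI entry)
  ultimately show thesis using that by blast
qed

lemma tendsto_qform:
  assumes "X \<longlonglongrightarrow> P" shows "(\<lambda>k. qform (X k) x) \<longlonglongrightarrow> qform P x"
proof -
  have "(\<lambda>k. X k *v x) \<longlonglongrightarrow> P *v x"
  proof (rule vec_tendstoI)
    fix i
    have "(\<lambda>k. \<Sum>j\<in>UNIV. X k $ i $ j * x $ j) \<longlonglongrightarrow> (\<Sum>j\<in>UNIV. P $ i $ j * x $ j)"
      by (intro tendsto_intros assms)
    then show "(\<lambda>k. (X k *v x) $ i) \<longlonglongrightarrow> (P *v x) $ i"
      by (simp add: matrix_vector_mult_def)
  qed
  then show ?thesis unfolding qform_def by (intro tendsto_intros)
qed

section \<open>Positive definite matrices\<close>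

lemma pos_def_sym: "pos_def A \<Longrightarrow> transpose A = A"
  and pos_def_qform_pos: "pos_def A \<Longrightarrow> x \<noteq> 0 \<Longrightarrow> 0 < qform A x"
  unfolding pos_def_def qform_def by blast+

lemma pos_def_qform_nonneg:
  assumes "pos_def A" shows "0 \<le> qform A x"
proof (cases "x = 0")
  case False
  then show ?thesis using pos_def_qform_pos[OF assms] less_imp_le by blast
qed (simp add: qform_def)

lemma pos_defI: "transpose A = A \<Longrightarrow> (\<And>x. x \<noteq> 0 \<Longrightarrow> 0 < qform A x) \<Longrightarrow> pos_def A"
  unfolding pos_def_def qform_def by blast

lemma pos_def_scaleR:
  assumes "pos_def A" "0 < t" shows "pos_def (t *\<^sub>R A)"
proof (rule pos_defI)
  show "transpose (t *\<^sub>R A) = t *\<^sub>R A" by (simp add: transpose_scalar pos_def_sym[OF assms(1)])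
  show "0 < qform (t *\<^sub>R A) x" if "x \<noteq> 0" for x
    using pos_def_qform_pos[OF assms(1) that] assms(2) by (simp add: qform_scaleR)
qed

lemma pos_def_invertible:
  assumes "pos_def A" shows "invertible A"
proof -
  have "x = 0" if "A *v x = 0" for x
    using pos_def_qform_pos[OF assms, of x] that by (auto simp: qform_def)
  then show ?thesis
    by (simp add: invertible_left_inverse matrix_left_invertible_ker)
qed

text \<open>
  The explicit constant matters when \<open>M\<close> tends to \<open>0\<close>: it then tends to \<open>0\<close> as well,
  uniformly in \<open>x\<close>.
\<close>

lemma qform_le_entry_sum: "qform M x \<le> (\<Sum>i\<in>UNIV. \<Sum>j\<in>UNIV. \<bar>M $ i $ j\<bar>) * (norm x)\<^sup>2"
proof -
  have "qform M x \<le> norm x * norm (M *v x)" unfolding qform_def by (rule norm_cauchy_schwarz)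
  also have "\<dots> \<le> norm x * (onorm ((*v) M) * norm x)"
    by (intro mult_left_mono onorm[OF matrix_vector_mul_bounded_linear]) simp
  also have "\<dots> \<le> norm x * ((\<Sum>i\<in>UNIV. \<Sum>j\<in>UNIV. \<bar>M $ i $ j\<bar>) * norm x)"
    by (intro mult_left_mono mult_right_mono onorm_le_matrix_component_sum) simp_all
  finally show ?thesis by (simp add: power2_eq_square ac_simps)
qed

lemma qform_upper_bound:
  obtains c where "c > 0" "\<And>x. qform M x \<le> c * (norm x)\<^sup>2"
proof
  let ?c = "\<Sum>i\<in>UNIV. \<Sum>j\<in>UNIV. \<bar>M $ i $ j\<bar>"
  show "?c + 1 > 0" by (intro add_nonneg_pos sum_nonneg) simp_all
  show "qform M x \<le> (?c + 1) * (norm x)\<^sup>2" for x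
    using qform_le_entry_sum[of M x] by (simp add: distrib_right add_increasing2)
qed

lemma pos_def_lower_bound:
  assumes "pos_def M"
  obtains c where "c > 0" "\<And>x. c * (norm x)\<^sup>2 \<le> qform M x"
proof -
  let ?S = "sphere 0 1 :: (real ^ 'a) set"
  have cont: "continuous_on ?S (qform M)"
    unfolding qform_def
    by (intro continuous_intros linear_continuous_on matrix_vector_mul_bounded_linear)
  have "axis undefined 1 \<in> ?S" by simp
  then have "?S \<noteq> {}" by blast
  then obtain x0 where x0: "x0 \<in> ?S" "\<And>x. x \<in> ?S \<Longrightarrow> qform M x0 \<le> qform M x"
    using continuous_attains_inf[OF compact_sphere _ cont] by blast
  have "0 < qform M x0" using x0(1) by (intro pos_def_qform_pos[OF assms]) auto
  moreover have "qform M x0 * (norm x)\<^sup>2 \<le> qform M x" for x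
  proof (cases "x = 0")
    case False
    have "qform M x0 \<le> qform M (x /\<^sub>R norm x)" using False by (intro x0(2)) simp
    also have "\<dots> = qform M x / (norm x)\<^sup>2"
      by (simp add: qform_def matrix_vector_mult_scaleR power2_eq_square divide_inverse)
    finally show ?thesis using False by (simp add: field_simps)
  qed (simp add: qform_def)
  ultimately show thesis using that by blast
qed

lemma pos_def_dominates:
  assumes "pos_def N"
  obtains s where "s \<ge> 1" "\<And>x. qform M x \<le> s * qform N x"
proof -
  obtain c where c: "c > 0" "\<And>x. qform M x \<le> c * (norm x)\<^sup>2" using qform_upper_bound[of M] by blast
  obtain d where d: "d > 0" "\<And>x. d * (norm x)\<^sup>2 \<le> qform N x" using pos_def_lower_bound[OF assms] by blast
  have "qform M x \<le> (1 + c / d) * qform N x" for x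
  proof -
    have "qform M x \<le> c / d * (d * (norm x)\<^sup>2)" using c(2)[of x] d(1) by simp
    also have "\<dots> \<le> c / d * qform N x" using c(1) d by (intro mult_left_mono) auto
    also have "\<dots> \<le> (1 + c / d) * qform N x"
      using pos_def_qform_nonneg[OF assms, of x] by (simp add: distrib_right)
    finally show ?thesis .
  qed
  then show thesis using that[of "1 + c / d"] c(1) d(1) by simp
qed

section \<open>The measurement update as a minimum\<close>

text \<open>
  The covariance after the measurement update, before the projection to the diagonal blocks.
\<close>

definition posterior :: "real ^ 'm::finite ^ 'k::finite \<Rightarrow> real ^ 'k ^ 'k \<Rightarrow> real ^ 'm ^ 'm \<Rightarrow> real ^ 'm ^ 'm"
  where "posterior H R P = P - P ** transpose H ** matrix_inv (H ** P ** transpose H + R) ** H ** P"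

text \<open>
  For \<open>y = K\<^sup>T u\<close> this is the form of \<open>(I - K H) P (I - K H)\<^sup>T + K R K\<^sup>T\<close> at \<open>u\<close>: the error
  variance in direction \<open>u\<close> of the linear estimator with gain \<open>K\<close>. It is affine and increasing
  in \<open>P\<close>.
\<close>

definition update_cost ::
    "real ^ 'm::finite ^ 'k::finite \<Rightarrow> real ^ 'k ^ 'k \<Rightarrow> real ^ 'm ^ 'm \<Rightarrow> real ^ 'm \<Rightarrow> real ^ 'k \<Rightarrow> real"
  where "update_cost H R P u y = qform P (u - transpose H *v y) + qform R y"

lemma innovation_pos_def:
  assumes "pos_def P" "pos_def R" shows "pos_def (H ** P ** transpose H + R)"
proof (rule pos_defI)
  show "transpose (H ** P ** transpose H + R) = H ** P ** transpose H + R"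
    by (simp only: transpose_add symmetric_congruence[OF pos_def_sym[OF assms(1)]] pos_def_sym[OF assms(2)])
  show "0 < qform (H ** P ** transpose H + R) x" if "x \<noteq> 0" for x
    unfolding qform_add qform_congruence
    using pos_def_qform_nonneg[OF assms(1)] pos_def_qform_pos[OF assms(2) that] by (rule add_nonneg_pos)
qed

lemma matrix_inv_right: "invertible S \<Longrightarrow> S ** matrix_inv S = mat 1"
  unfolding invertible_def matrix_inv_def by (rule someI2_ex) auto

lemma matrix_inv_symmetric:
  fixes S :: "real ^ 'k::finite ^ 'k"
  assumes "invertible S" "transpose S = S"
  shows "transpose (matrix_inv S) = matrix_inv S"
proof -
  have "transpose (matrix_inv S) ** S = mat 1"
    by (metis assms matrix_inv_right matrix_transpose_mul transpose_mat)
  then have "transpose (matrix_inv S) ** S ** matrix_inv S = matrix_inv S" by simp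
  then show ?thesis
    by (simp add: matrix_mul_assoc[symmetric] matrix_inv_right assms(1))
qed

lemma posterior_symmetric:
  assumes "pos_def P" "pos_def R" shows "transpose (posterior H R P) = posterior H R P"
proof -
  note S = innovation_pos_def[OF assms, of H]
  show ?thesis
    unfolding posterior_def
    by (simp add: transpose_diff matrix_transpose_mul matrix_mul_assoc pos_def_sym[OF assms(1)]
        matrix_inv_symmetric[OF pos_def_invertible[OF S] pos_def_sym[OF S]])
qed

text \<open>
  Completing the square in \<open>y\<close>. The posterior form at \<open>u\<close> is thereby the minimum of the cost
  over \<open>y\<close>, so it inherits monotonicity and subhomogeneity from the cost, and no inverse
  matrix has to be handled after this point.
\<close>

lemma update_cost_complete_square:
  fixes H :: "real ^ 'm::finite ^ 'k::finite"
  assumes "pos_def P" "pos_def R"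
  defines "S \<equiv> H ** P ** transpose H + R"
  shows "update_cost H R P u y
    = qform (posterior H R P) u + qform S (y - matrix_inv S *v (H *v (P *v u)))"
proof -
  define z where "z = H *v (P *v u)"
  define y0 where "y0 = matrix_inv S *v z"
  have S: "pos_def S" unfolding S_def using assms by (intro innovation_pos_def)
  have Sy0: "S *v y0 = z"
    by (simp add: y0_def matrix_vector_mul_assoc matrix_inv_right pos_def_invertible[OF S])
  have "qform (posterior H R P) u = qform P u - u \<bullet> (P *v (transpose H *v y0))"
    unfolding posterior_def S_def[symmetric] qform_diff
    by (simp add: qform_def y0_def z_def matrix_vector_mul_assoc matrix_mul_assoc)
  also have "u \<bullet> (P *v (transpose H *v y0)) = y0 \<bullet> z"
    by (metis z_def inner_matrix_transpose inner_commute pos_def_sym[OF assms(1)])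
  finally have post: "qform (posterior H R P) u = qform P u - y0 \<bullet> z" .
  have "qform P (u - transpose H *v y) = qform P u - 2 * (y \<bullet> z) + qform P (transpose H *v y)"
  proof -
    have "u \<bullet> (P *v (transpose H *v y)) = y \<bullet> z" "(transpose H *v y) \<bullet> (P *v u) = y \<bullet> z"
      by (metis z_def inner_matrix_transpose inner_commute pos_def_sym[OF assms(1)])+
    then show ?thesis
      by (simp add: qform_def matrix_vector_mult_diff_distrib inner_diff_left inner_diff_right)
  qed
  then have "update_cost H R P u y = qform P u - 2 * (y \<bullet> z) + qform S y"
    by (simp add: update_cost_def S_def qform_add qform_congruence)
  moreover have "qform S (y - y0) = qform S y - 2 * (y \<bullet> z) + y0 \<bullet> z"
    using symmetric_inner_commute[OF pos_def_sym[OF S], of y0 y]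
    by (simp add: qform_def matrix_vector_mult_diff_distrib inner_diff_left inner_diff_right Sy0)
  ultimately show ?thesis using post by (simp add: y0_def z_def)
qed

lemma posterior_le_update_cost:
  assumes "pos_def P" "pos_def R"
  shows "qform (posterior H R P) u \<le> update_cost H R P u y"
  unfolding update_cost_complete_square[OF assms]
  using pos_def_qform_nonneg[OF innovation_pos_def[OF assms]] by (simp only: le_add_same_cancel1)

lemma posterior_attained:
  assumes "pos_def P" "pos_def R"
  obtains y where "qform (posterior H R P) u = update_cost H R P u y"
proof
  show "qform (posterior H R P) u = update_cost H R P u
      (matrix_inv (H ** P ** transpose H + R) *v (H *v (P *v u)))"
    unfolding update_cost_complete_square[OF assms] by (simp add: qform_def)
qed

text \<open>
  The minimizer for the larger matrix is a competitor for the smaller one.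
\<close>

lemma posterior_mono:
  assumes "pos_def P" "pos_def P'" "pos_def R" "\<And>x. qform P x \<le> qform P' x"
  shows "qform (posterior H R P) u \<le> qform (posterior H R P') u"
proof -
  obtain y where y: "qform (posterior H R P') u = update_cost H R P' u y"
    using posterior_attained[OF assms(2,3)] by blast
  have "qform (posterior H R P) u \<le> update_cost H R P u y"
    by (rule posterior_le_update_cost[OF assms(1,3)])
  also have "\<dots> \<le> update_cost H R P' u y" by (simp add: update_cost_def assms(4))
  finally show ?thesis using y by simp
qed

lemma posterior_nonneg:
  assumes "pos_def P" "pos_def R" shows "0 \<le> qform (posterior H R P) u"
proof -
  obtain y where y: "qform (posterior H R P) u = update_cost H R P u y"
    using posterior_attained[OF assms] by blast
  show ?thesis unfolding y update_cost_def by (intro add_nonneg_nonneg pos_def_qform_nonneg assms)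
qed

text \<open>
  Shrinking \<open>P\<close> alone shrinks the cost by less than the factor \<open>t\<close>, since the noise term of
  the cost stays as it is.
\<close>

lemma posterior_subhomogeneous:
  assumes "pos_def P" "pos_def R" "0 < t" "t \<le> 1"
  shows "t * qform (posterior H R P) u \<le> qform (posterior H R (t *\<^sub>R P)) u"
proof -
  obtain y where y: "qform (posterior H R (t *\<^sub>R P)) u = update_cost H R (t *\<^sub>R P) u y"
    using posterior_attained[OF pos_def_scaleR[OF assms(1,3)] assms(2)] by blast
  have "t * qform R y \<le> 1 * qform R y"
    by (intro mult_right_mono pos_def_qform_nonneg assms)
  moreover have "t * qform (posterior H R P) u \<le> t * update_cost H R P u y"
    using assms by (intro mult_left_mono posterior_le_update_cost) auto
  ultimately show ?thesis
    unfolding y by (simp add: update_cost_def qform_scaleR distrib_left)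
qed

lemma posterior_superhomogeneous:
  assumes "pos_def P" "pos_def R" "1 \<le> s"
  shows "qform (posterior H R (s *\<^sub>R P)) u \<le> s * qform (posterior H R P) u"
proof -
  have "1 / s * qform (posterior H R (s *\<^sub>R P)) u
      \<le> qform (posterior H R ((1 / s) *\<^sub>R (s *\<^sub>R P))) u"
    using assms by (intro posterior_subhomogeneous pos_def_scaleR) auto
  then have "1 / s * qform (posterior H R (s *\<^sub>R P)) u \<le> qform (posterior H R P) u"
    using assms(3) by simp
  then show ?thesis using assms(3) by (simp add: pos_divide_le_eq mult.commute)
qed

section \<open>Blocks of a vector\<close>

definition block_part :: "'n \<Rightarrow> real ^ ('n::finite \<times> 'c::finite) \<Rightarrow> real ^ ('n \<times> 'c)"
  where "block_part i x = (\<chi> r. if fst r = i then x $ r else 0)"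

lemma sum_block_parts: "(\<Sum>i\<in>UNIV. block_part i x) = x"
  by (simp add: vec_eq_iff block_part_def)

lemma block_part_block_part: "block_part i (block_part j x) = (if i = j then block_part i x else 0)"
  by (auto simp: vec_eq_iff block_part_def)

lemma block_part_diff: "block_part i (x - y) = block_part i x - block_part i y"
  by (simp add: vec_eq_iff block_part_def)

lemma inner_block_part: "block_part i x \<bullet> y = block_part i x \<bullet> block_part i y"
  unfolding inner_vec_def by (rule sum.cong) (auto simp: block_part_def)

lemma block_diag_mult_block_part: "block_diag B *v block_part i x = block_part i (block_diag B *v x)"
proof -
  have "(\<Sum>s\<in>UNIV. (if fst r = fst s then B (fst r) $ snd r $ snd s else 0) * (if fst s = i then x $ s else 0))
      = (if fst r = i then \<Sum>s\<in>UNIV. (if fst r = fst s then B (fst r) $ snd r $ snd s else 0) * x $ s else 0)"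
    for r by (auto intro!: sum.cong sum.neutral)
  then show ?thesis
    by (simp add: vec_eq_iff matrix_vector_mult_def block_diag_def block_part_def)
qed

lemma transpose_block_diag: "transpose (block_diag B) = block_diag (\<lambda>i. transpose (B i))"
  by (simp add: vec_eq_iff transpose_def block_diag_def)

lemma transpose_block_diag_proj:
  assumes "transpose M = M" shows "transpose (block_diag_proj M) = block_diag_proj M"
  by (simp add: vec_eq_iff transpose_def block_diag_proj_def block_diag_def block_def)
    (intro allI symmetric_entries[OF assms])

text \<open>
  This formula makes the block projection monotone for the order of quadratic forms.
\<close>

lemma qform_block_diag_proj: "qform (block_diag_proj M) x = (\<Sum>i\<in>UNIV. qform M (block_part i x))"
proof -
  have inner: "(\<Sum>s\<in>UNIV. M $ r $ s * (if fst s = fst r then x $ s else 0)) = (block_diag_proj M *v x) $ r" for r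
    unfolding matrix_vector_mult_def block_diag_proj_def block_diag_def block_def
    by (auto intro!: sum.cong)
  have "(\<Sum>i\<in>UNIV. qform M (block_part i x))
      = (\<Sum>r\<in>UNIV. \<Sum>i\<in>UNIV. (if fst r = i then x $ r else 0) *
          (\<Sum>s\<in>UNIV. M $ r $ s * (if fst s = i then x $ s else 0)))"
    unfolding qform_def inner_vec_def matrix_vector_mult_def block_part_def
    by (subst sum.swap) simp
  also have "\<dots> = (\<Sum>r\<in>UNIV. \<Sum>i\<in>UNIV. if fst r = i then x $ r *
          (\<Sum>s\<in>UNIV. M $ r $ s * (if fst s = fst r then x $ s else 0)) else 0)"
    by (intro sum.cong) auto
  also have "\<dots> = qform (block_diag_proj M) x"
    by (simp add: inner qform_def inner_vec_def)
  finally show ?thesis by simp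
qed

text \<open>
  Block diagonality, in the only form in which it is used: no cross terms between different
  blocks in the quadratic form.
\<close>

definition block_decoupled :: "real ^ ('n::finite \<times> 'c::finite) ^ ('n \<times> 'c) \<Rightarrow> bool"
  where "block_decoupled M \<longleftrightarrow> (\<forall>x. (\<Sum>i\<in>UNIV. qform M (block_part i x)) = qform M x)"

lemma block_decoupled_block_diag: "block_decoupled (block_diag B)"
proof -
  have "(\<Sum>i\<in>UNIV. qform (block_diag B) (block_part i x)) = qform (block_diag B) x" for x
  proof -
    have "qform (block_diag B) x = (\<Sum>i\<in>UNIV. block_part i x \<bullet> (block_diag B *v x))"
      unfolding qform_def inner_sum_left[symmetric] sum_block_parts ..
    also have "\<dots> = (\<Sum>i\<in>UNIV. qform (block_diag B) (block_part i x))"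
      unfolding qform_def block_diag_mult_block_part
      by (rule sum.cong) (simp_all flip: inner_block_part)
    finally show ?thesis by (rule sym)
  qed
  then show ?thesis unfolding block_decoupled_def by blast
qed

lemma block_decoupled_mat: "block_decoupled (mat q)"
proof -
  have eq: "mat q = block_diag (\<lambda>i. mat q)"
    by (auto simp: vec_eq_iff mat_def block_diag_def prod_eq_iff)
  show ?thesis by (subst eq) (rule block_decoupled_block_diag)
qed

text \<open>
  Optimizing the cost for each block separately is no worse than using the block parts of the
  joint minimizer \<open>y\<close>; for block-diagonal data the costs of these parts add up to the joint cost.
\<close>

lemma block_parts_posterior_le:
  assumes "pos_def P" "pos_def R" "block_decoupled P" "block_decoupled R"
    and H: "H = block_diag Hb"
  shows "(\<Sum>i\<in>UNIV. qform (posterior H R P) (block_part i u)) \<le> qform (posterior H R P) u"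
proof -
  obtain y where y: "qform (posterior H R P) u = update_cost H R P u y"
    using posterior_attained[OF assms(1,2)] by blast
  have HT: "transpose H *v block_part i y = block_part i (transpose H *v y)" for i
    unfolding H transpose_block_diag by (rule block_diag_mult_block_part)
  have "(\<Sum>i\<in>UNIV. qform (posterior H R P) (block_part i u))
      \<le> (\<Sum>i\<in>UNIV. update_cost H R P (block_part i u) (block_part i y))"
    by (intro sum_mono posterior_le_update_cost assms)
  also have "\<dots> = update_cost H R P u y"
    unfolding update_cost_def HT block_part_diff[symmetric] sum.distrib
    using assms(3,4) unfolding block_decoupled_def by simp
  finally show ?thesis using y by simp
qed

section \<open>The order properties of the Riccati map\<close>

text \<open>
  One full step of the filter, from one predicted covariance to the next.
\<close>

definition riccati_map ::
    "real ^ ('n::finite \<times> 'c::finite) ^ ('n \<times> 'c) \<Rightarrow> real ^ ('n \<times> 'c) ^ ('n \<times> 'c) \<Rightarrow>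
     real ^ ('n \<times> 'c) ^ ('n \<times> 'd::finite) \<Rightarrow> real ^ ('n \<times> 'd) ^ ('n \<times> 'd) \<Rightarrow>
     real ^ ('n \<times> 'c) ^ ('n \<times> 'c) \<Rightarrow> real ^ ('n \<times> 'c) ^ ('n \<times> 'c)"
  where "riccati_map F Q H R P = F ** block_diag_proj (posterior H R P) ** transpose F + Q"

lemma qform_riccati_map:
  "qform (riccati_map F Q H R P) x
    = (\<Sum>i\<in>UNIV. qform (posterior H R P) (block_part i (transpose F *v x))) + qform Q x"
  by (simp add: riccati_map_def qform_add qform_congruence qform_block_diag_proj)

lemma riccati_map_ge:
  assumes "pos_def P" "pos_def R" shows "qform Q x \<le> qform (riccati_map F Q H R P) x"
  unfolding qform_riccati_map by (simp add: sum_nonneg posterior_nonneg[OF assms])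

lemma riccati_map_pos_def:
  assumes "pos_def P" "pos_def R" "pos_def Q" shows "pos_def (riccati_map F Q H R P)"
proof (rule pos_defI)
  show "transpose (riccati_map F Q H R P) = riccati_map F Q H R P"
    unfolding riccati_map_def transpose_add pos_def_sym[OF assms(3)]
    using posterior_symmetric[OF assms(1,2)]
    by (simp add: symmetric_congruence transpose_block_diag_proj)
  show "0 < qform (riccati_map F Q H R P) x" if "x \<noteq> 0" for x
    using pos_def_qform_pos[OF assms(3) that] riccati_map_ge[OF assms(1,2)] by (rule less_le_trans)
qed

lemma riccati_iterates_pos_def:
  assumes "pos_def P" "pos_def R" "pos_def Q" shows "pos_def ((riccati_map F Q H R ^^ k) P)"
  by (induction k) (simp_all add: assms riccati_map_pos_def)

lemma riccati_map_mono:
  assumes "pos_def P" "pos_def P'" "pos_def R"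
    and "\<And>x. qform P x \<le> qform P' x" "\<And>x. qform Q x \<le> qform Q' x"
  shows "qform (riccati_map F Q H R P) x \<le> qform (riccati_map F Q' H R P') x"
  unfolding qform_riccati_map
  by (intro add_mono sum_mono posterior_mono[OF assms(1,2,3)] assms(4,5))

text \<open>
  The noise \<open>Q\<close> is not scaled with \<open>P\<close>. The surplus \<open>(1 - t) Q\<close> that this leaves is the source
  of the contraction towards a fixed point.
\<close>

lemma riccati_map_shrink:
  assumes "pos_def P" "pos_def R" "0 < t" "t \<le> 1"
  shows "t * qform (riccati_map F Q H R P) x + (1 - t) * qform Q x
    \<le> qform (riccati_map F Q H R (t *\<^sub>R P)) x"
proof -
  have "t * (\<Sum>i\<in>UNIV. qform (posterior H R P) (block_part i (transpose F *v x)))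
      \<le> (\<Sum>i\<in>UNIV. qform (posterior H R (t *\<^sub>R P)) (block_part i (transpose F *v x)))"
    unfolding sum_distrib_left by (intro sum_mono posterior_subhomogeneous assms)
  then show ?thesis by (simp add: qform_riccati_map algebra_simps)
qed

lemma riccati_map_stretch:
  assumes "pos_def P" "pos_def R" "1 \<le> s"
  shows "qform (riccati_map F Q H R (s *\<^sub>R P)) x
    \<le> s * qform (riccati_map F Q H R P) x - (s - 1) * qform Q x"
proof -
  have "(\<Sum>i\<in>UNIV. qform (posterior H R (s *\<^sub>R P)) (block_part i (transpose F *v x)))
      \<le> s * (\<Sum>i\<in>UNIV. qform (posterior H R P) (block_part i (transpose F *v x)))"
    unfolding sum_distrib_left by (intro sum_mono posterior_superhomogeneous assms)
  then show ?thesis by (simp add: qform_riccati_map algebra_simps)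
qed

section \<open>Global attraction of a fixed point\<close>

text \<open>
  Squeeze \<open>X\<close> between multiples \<open>t P\<close> and \<open>s P\<close> of the fixed point, \<open>t \<le> 1 \<le> s\<close>. If \<open>e P \<le> Q\<close>,
  then shrinking and stretching show that each step multiplies both \<open>1 - t\<close> and \<open>s - 1\<close> by
  \<open>1 - e\<close>, so the two bounds close up geometrically.
\<close>

lemma riccati_iterates_tendsto_fixed_point:
  assumes P: "pos_def P" and fixed: "riccati_map F Q H R P = P"
    and R: "pos_def R" and Q: "pos_def Q" and X: "pos_def X"
  shows "(\<lambda>k. (riccati_map F Q H R ^^ k) X) \<longlonglongrightarrow> P"
proof -
  let ?h = "riccati_map F Q H R"
  let ?X = "\<lambda>k. (?h ^^ k) X"
  obtain c where c: "c \<ge> 1" "\<And>x. qform P x \<le> c * qform Q x" using pos_def_dominates[OF Q] by blast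
  obtain s where s: "s \<ge> 1" "\<And>x. qform X x \<le> s * qform P x" using pos_def_dominates[OF P] by blast
  obtain s' where s': "s' \<ge> 1" "\<And>x. qform P x \<le> s' * qform X x" using pos_def_dominates[OF X] by blast
  define e where "e = 1 / c"
  define t where "t = 1 / s'"
  have e: "0 < e" "e \<le> 1" "\<And>x. e * qform P x \<le> qform Q x"
    using c by (simp_all add: e_def field_simps)
  have t: "0 < t" "t \<le> 1" "\<And>x. t * qform P x \<le> qform X x"
    using s' by (simp_all add: t_def field_simps)
  have XP: "pos_def (?X k)" for k by (intro riccati_iterates_pos_def X R Q)
  define d where "d k = (1 - e) ^ k" for k
  have d: "0 \<le> d k" "d k \<le> 1" for k unfolding d_def using e by (simp_all add: power_le_one)
  have upper: "qform (?X k) x \<le> (1 + (s - 1) * d k) * qform P x" for k x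
  proof (induction k arbitrary: x)
    case 0 then show ?case using s by (simp add: d_def)
  next
    case (Suc k)
    let ?s = "1 + (s - 1) * d k"
    have s1: "?s \<ge> 1" using s(1) d(1)[of k] by simp
    have "qform (?X (Suc k)) x = qform (?h (?X k)) x" by simp
    also have "\<dots> \<le> qform (?h (?s *\<^sub>R P)) x"
      using s1 by (intro riccati_map_mono XP R pos_def_scaleR P) (simp_all add: Suc qform_scaleR)
    also have "\<dots> \<le> ?s * qform P x - (?s - 1) * qform Q x"
      using riccati_map_stretch[OF P R s1, of F Q H x] unfolding fixed .
    also have "\<dots> \<le> ?s * qform P x - (?s - 1) * (e * qform P x)"
      using s1 e(3)[of x] by (intro diff_left_mono mult_left_mono) auto
    also have "\<dots> = (1 + (s - 1) * d (Suc k)) * qform P x" by (simp add: d_def algebra_simps)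
    finally show ?case .
  qed
  have lower: "(1 - (1 - t) * d k) * qform P x \<le> qform (?X k) x" for k x
  proof (induction k arbitrary: x)
    case 0 then show ?case using t by (simp add: d_def)
  next
    case (Suc k)
    let ?t = "1 - (1 - t) * d k"
    have "(1 - t) * d k \<le> 1 - t" using t(2) d[of k] by (simp add: mult_left_le)
    then have t1: "0 < ?t" "?t \<le> 1" using t(1,2) d(1)[of k] by simp_all
    have "(1 - (1 - t) * d (Suc k)) * qform P x = ?t * qform P x + (1 - ?t) * (e * qform P x)"
      by (simp add: d_def algebra_simps)
    also have "\<dots> \<le> ?t * qform P x + (1 - ?t) * qform Q x"
      using t1 e(3)[of x] by (intro add_left_mono mult_left_mono) auto
    also have "\<dots> \<le> qform (?h (?t *\<^sub>R P)) x"
      using riccati_map_shrink[OF P R t1, of F Q H x] unfolding fixed .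
    also have "\<dots> \<le> qform (?h (?X k)) x"
      using t1 by (intro riccati_map_mono XP R pos_def_scaleR P) (simp_all add: Suc qform_scaleR)
    finally show ?case by simp
  qed
  have d0: "d \<longlonglongrightarrow> 0" unfolding d_def using e by (intro LIMSEQ_power_zero) simp
  show ?thesis
  proof (rule tendsto_matrix_if_qform_tendsto)
    fix x
    have "(\<lambda>k. (1 + (s - 1) * d k) * qform P x) \<longlonglongrightarrow> (1 + (s - 1) * 0) * qform P x"
      by (intro tendsto_intros d0)
    then have up: "(\<lambda>k. (1 + (s - 1) * d k) * qform P x) \<longlonglongrightarrow> qform P x" by simp
    have "(\<lambda>k. (1 - (1 - t) * d k) * qform P x) \<longlonglongrightarrow> (1 - (1 - t) * 0) * qform P x"
      by (intro tendsto_intros d0)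
    then have lo: "(\<lambda>k. (1 - (1 - t) * d k) * qform P x) \<longlonglongrightarrow> qform P x" by simp
    show "(\<lambda>k. qform (?X k) x) \<longlonglongrightarrow> qform P x"
      by (rule tendsto_sandwich[OF always_eventually always_eventually lo up])
        (blast intro: lower upper)+
  qed (rule pos_def_sym, rule XP P)+
qed

section \<open>Existence of a fixed point\<close>

text \<open>
  A detectability gain \<open>L\<close> need not be block diagonal, hence it cannot be inserted below the
  block projection. The comparison therefore runs through the recursion with \<open>Q\<close> replaced by a
  multiple \<open>q I\<close> of the identity, which dominates the given one. Started at \<open>q I\<close>, its iterates
  are block diagonal, so the projected posterior is at most the full one, and this is bounded by
  the cost of the gain \<open>L\<close>. What remains is the recursion \<open>X \<mapsto> A X A\<^sup>T + L R L\<^sup>T + q I\<close> with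
  \<open>A = F - L H\<close> stable, for which \<open>V\<close> is a supersolution.
\<close>

lemma riccati_iterates_bounded:
  assumes F: "F = block_diag Fb" and H: "H = block_diag Hb" and R: "R = block_diag Rb"
    and pos: "pos_def R" "pos_def Q" and det: "detectable F H"
  obtains V where "\<And>k x. qform ((riccati_map F Q H R ^^ k) Q) x \<le> V x"
proof -
  obtain L where eig: "\<And>z. eigenvalue (map_matrix complex_of_real (F - L ** H)) z \<Longrightarrow> cmod z < 1"
    using det unfolding detectable_def by blast
  let ?B = "(*v) (transpose (F - L ** H))"
  obtain m where m: "m > 0" "\<And>x. (norm ((?B ^^ m) x))\<^sup>2 \<le> (norm x)\<^sup>2 / 2"
    using transpose_power_contraction[OF eig] by blast
  obtain q where q: "q > 0" "\<And>x. qform Q x \<le> q * (norm x)\<^sup>2" using qform_upper_bound[of Q] by blast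
  obtain r where r: "r > 0" "\<And>x. qform (L ** R ** transpose L) x \<le> r * (norm x)\<^sup>2"
    using qform_upper_bound by blast
  define V where "V x = 2 * (r + q) * (\<Sum>j<m. (norm ((?B ^^ j) x))\<^sup>2)" for x
  \<comment> \<open>The sum over a full orbit segment telescopes; the m-th power costs only half of what the first term gains.\<close>
  have V_step: "V (?B x) + (r + q) * (norm x)\<^sup>2 \<le> V x" for x
  proof -
    have "(\<Sum>j<m. (norm ((?B ^^ j) (?B x)))\<^sup>2) + (norm x)\<^sup>2 = (\<Sum>j<Suc m. (norm ((?B ^^ j) x))\<^sup>2)"
      unfolding sum.lessThan_Suc_shift by (simp add: funpow_swap1)
    also have "\<dots> \<le> (\<Sum>j<m. (norm ((?B ^^ j) x))\<^sup>2) + (norm x)\<^sup>2 / 2"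
      using m(2)[of x] by simp
    finally have "2 * (r + q) * ((\<Sum>j<m. (norm ((?B ^^ j) (?B x)))\<^sup>2) + (norm x)\<^sup>2 / 2)
        \<le> 2 * (r + q) * (\<Sum>j<m. (norm ((?B ^^ j) x))\<^sup>2)"
      using q(1) r(1) by (intro mult_left_mono) auto
    then show ?thesis by (simp add: V_def algebra_simps)
  qed
  have V_ge: "q * (norm x)\<^sup>2 \<le> V x" for x
  proof -
    have "(norm ((?B ^^ 0) x))\<^sup>2 \<le> (\<Sum>j<m. (norm ((?B ^^ j) x))\<^sup>2)"
      using m(1) by (intro member_le_sum) auto
    then have "2 * (r + q) * (norm x)\<^sup>2 \<le> V x"
      unfolding V_def using q(1) r(1) by (intro mult_left_mono) auto
    moreover have "q * (norm x)\<^sup>2 \<le> 2 * (r + q) * (norm x)\<^sup>2"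
      using q(1) r(1) by (intro mult_right_mono) auto
    ultimately show ?thesis by linarith
  qed
  have qI: "pos_def (mat q)"
    using q(1) by (intro pos_defI) (simp_all add: transpose_mat qform_mat)
  let ?c = "\<lambda>k. (riccati_map F (mat q) H R ^^ k) (mat q)"
  have cP: "pos_def (?c k)" for k by (intro riccati_iterates_pos_def qI pos)
  have FT: "transpose F *v block_part i x = block_part i (transpose F *v x)" for i x
    unfolding F transpose_block_diag by (rule block_diag_mult_block_part)
  have dec: "block_decoupled (?c k)" for k
  proof (cases k)
    case 0 then show ?thesis by (simp add: block_decoupled_mat)
  next
    case (Suc l)
    have "(\<Sum>j\<in>UNIV. qform (riccati_map F (mat q) H R P) (block_part j x))
        = qform (riccati_map F (mat q) H R P) x" for P x
    proof -
      \<comment> \<open>A vector supported on block j has only one nonzero block part.\<close>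
      have "(\<Sum>i\<in>UNIV. qform (posterior H R P) (block_part i (block_part j u)))
          = qform (posterior H R P) (block_part j u)" for j u
      proof -
        have "(\<Sum>i\<in>UNIV. qform (posterior H R P) (block_part i (block_part j u)))
            = (\<Sum>i\<in>UNIV. if i = j then qform (posterior H R P) (block_part j u) else 0)"
          by (rule sum.cong) (auto simp: block_part_block_part qform_def)
        then show ?thesis by simp
      qed
      moreover have "(\<Sum>j\<in>UNIV. qform (mat q) (block_part j x)) = qform (mat q) x"
        using block_decoupled_mat unfolding block_decoupled_def by blast
      ultimately show ?thesis by (simp add: qform_riccati_map FT sum.distrib)
    qed
    then show ?thesis unfolding Suc by (simp add: block_decoupled_def)
  qed
  have R_dec: "block_decoupled R" unfolding R by (rule block_decoupled_block_diag)
  have cV: "qform (?c k) x \<le> V x" for k x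
  proof (induction k arbitrary: x)
    case 0 then show ?case using V_ge by (simp add: qform_mat)
  next
    case (Suc k)
    let ?u = "transpose F *v x" and ?y = "transpose L *v x"
    \<comment> \<open>With this choice of y the one-step prediction error is propagated by the stable matrix F - L H.\<close>
    have u: "?u - transpose H *v ?y = ?B x"
      by (simp add: transpose_diff matrix_transpose_mul matrix_vector_mult_diff_rdistrib matrix_vector_mul_assoc)
    have "qform (?c (Suc k)) x = (\<Sum>i\<in>UNIV. qform (posterior H R (?c k)) (block_part i ?u)) + q * (norm x)\<^sup>2"
      by (simp add: qform_riccati_map qform_mat)
    also have "\<dots> \<le> qform (posterior H R (?c k)) ?u + q * (norm x)\<^sup>2"
      by (intro add_right_mono block_parts_posterior_le[OF cP pos(1) dec R_dec H])
    also have "\<dots> \<le> update_cost H R (?c k) ?u ?y + q * (norm x)\<^sup>2"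
      by (intro add_right_mono posterior_le_update_cost cP pos)
    also have "\<dots> = qform (?c k) (?B x) + qform (L ** R ** transpose L) x + q * (norm x)\<^sup>2"
      unfolding update_cost_def u qform_congruence ..
    also have "\<dots> \<le> V (?B x) + r * (norm x)\<^sup>2 + q * (norm x)\<^sup>2"
      by (intro add_mono Suc r(2)) simp
    also have "\<dots> \<le> V x" using V_step[of x] by (simp add: distrib_right)
    finally show ?case .
  qed
  have "qform ((riccati_map F Q H R ^^ k) Q) x \<le> qform (?c k) x" for k x
  proof (induction k arbitrary: x)
    case 0 then show ?case using q(2) by (simp add: qform_mat)
  next
    case (Suc k)
    have "qform (riccati_map F Q H R ((riccati_map F Q H R ^^ k) Q)) x
        \<le> qform (riccati_map F (mat q) H R (?c k)) x"
      by (intro riccati_map_mono riccati_iterates_pos_def pos qI Suc) (simp only: qform_mat q(2))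
    then show ?case by simp
  qed
  then show thesis by (intro that[of V] order_trans[OF _ cV])
qed

text \<open>
  The iterates from \<open>Q\<close> increase, since every iterate is at least \<open>Q\<close> and the map is monotone.
  Being bounded they have a limit \<open>P\<close>. Monotonicity gives one inequality of the fixed point
  equation. The other one uses subhomogeneity in place of continuity of the inverse: the iterates
  are at least \<open>t P\<close> for factors \<open>t\<close> tending to \<open>1\<close>, so their images are at least \<open>t\<close> times the image of \<open>P\<close>.
\<close>

lemma riccati_fixed_point_exists:
  assumes F: "F = block_diag Fb" and H: "H = block_diag Hb" and R: "R = block_diag Rb"
    and pos: "pos_def R" "pos_def Q" and det: "detectable F H"
  obtains P where "pos_def P" "riccati_map F Q H R P = P"
proof -
  let ?h = "riccati_map F Q H R"
  let ?a = "\<lambda>k. (?h ^^ k) Q"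
  have aP: "pos_def (?a k)" for k by (intro riccati_iterates_pos_def pos)
  have incr: "qform (?a k) x \<le> qform (?a (Suc k)) x" for k x
  proof (induction k arbitrary: x)
    case 0 show ?case using riccati_map_ge[OF pos(2,1)] by simp
  next
    case (Suc k)
    have "qform (?h (?a k)) x \<le> qform (?h (?a (Suc k))) x"
      using Suc by (intro riccati_map_mono aP pos order_refl)
    then show ?case by simp
  qed
  then have inc: "incseq (\<lambda>k. qform (?a k) x)" for x by (intro incseq_SucI)
  obtain V where V: "\<And>k x. qform (?a k) x \<le> V x"
    using riccati_iterates_bounded[OF assms] by blast
  have "convergent (\<lambda>k. qform (?a k) x)" for x
  proof -
    obtain l where "(\<lambda>k. qform (?a k) x) \<longlonglongrightarrow> l"
      using incseq_convergent[OF inc[of x], of "V x"] V by blast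
    then show ?thesis by (rule convergentI)
  qed
  then obtain P where P: "transpose P = P" "?a \<longlonglongrightarrow> P"
    using symmetric_limit_if_qform_convergent[of ?a] pos_def_sym[OF aP] by blast
  have lim: "(\<lambda>k. qform (?a k) x) \<longlonglongrightarrow> qform P x" for x by (rule tendsto_qform[OF P(2)])
  have le: "qform (?a k) x \<le> qform P x" for k x by (rule incseq_le[OF inc lim])
  have PP: "pos_def P"
  proof (rule pos_defI[OF P(1)])
    show "0 < qform P x" if "x \<noteq> 0" for x
      using pos_def_qform_pos[OF pos(2) that] le[of 0 x] by simp
  qed
  have ge: "qform P x \<le> qform (?h P) x" for x
  proof (rule LIMSEQ_le_const2[OF LIMSEQ_Suc[OF lim]])
    have "qform (?a (Suc k)) x \<le> qform (?h P) x" for k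
      using riccati_map_mono[OF aP PP pos(1) le order_refl] by simp
    then show "\<exists>N. \<forall>k\<ge>N. qform (?a (Suc k)) x \<le> qform (?h P) x" by blast
  qed
  have "qform (?h P) x \<le> qform P x" for x
  proof -
    obtain l where l: "l > 0" "\<And>x. l * (norm x)\<^sup>2 \<le> qform P x" using pos_def_lower_bound[OF PP] by blast
    define e where "e k = (\<Sum>i\<in>UNIV. \<Sum>j\<in>UNIV. \<bar>(P - ?a k) $ i $ j\<bar>)" for k
    define t where "t k = 1 - e k / l" for k
    have "(\<lambda>k. (P - ?a k) $ i $ j) \<longlonglongrightarrow> (P - P) $ i $ j" for i j
      by (intro tendsto_intros P(2))
    then have "(\<lambda>k. (P - ?a k) $ i $ j) \<longlonglongrightarrow> 0" for i j by simp
    then have "e \<longlonglongrightarrow> 0"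
      unfolding e_def by (intro tendsto_null_sum tendsto_rabs_zero)
    then have "t \<longlonglongrightarrow> 1 - 0 / l" unfolding t_def by (intro tendsto_intros) (use l in auto)
    then have t1: "t \<longlonglongrightarrow> 1" by simp
    have e0: "e k \<ge> 0" for k unfolding e_def by (intro sum_nonneg) simp
    have t_le: "t k \<le> 1" for k using e0[of k] l(1) by (simp add: t_def)
    have ta: "t k * qform P x \<le> qform (?a k) x" for k x
    proof -
      have "qform P x - qform (?a k) x \<le> e k * (norm x)\<^sup>2"
        using qform_le_entry_sum[of "P - ?a k" x] unfolding e_def qform_diff .
      also have "\<dots> = e k / l * (l * (norm x)\<^sup>2)" using l(1) by simp
      also have "\<dots> \<le> e k / l * qform P x" using e0[of k] l by (intro mult_left_mono) auto
      finally show ?thesis by (simp add: t_def algebra_simps)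
    qed
    have "t k * qform (?h P) x \<le> qform (?a (Suc k)) x" if "t k > 0" for k
    proof -
      have "t k * qform (?h P) x \<le> t k * qform (?h P) x + (1 - t k) * qform Q x"
        using t_le[of k] pos_def_qform_nonneg[OF pos(2), of x] by simp
      also have "\<dots> \<le> qform (?h (t k *\<^sub>R P)) x"
        by (rule riccati_map_shrink[OF PP pos(1) that t_le])
      also have "\<dots> \<le> qform (?h (?a k)) x"
        by (intro riccati_map_mono pos_def_scaleR PP that aP pos order_refl) (simp add: qform_scaleR ta)
      finally show ?thesis by simp
    qed
    then have ev: "\<forall>\<^sub>F k in sequentially. t k * qform (?h P) x \<le> qform (?a (Suc k)) x"
      using order_tendstoD(1)[OF t1, of 0] by (auto elim: eventually_mono)
    have "(\<lambda>k. t k * qform (?h P) x) \<longlonglongrightarrow> 1 * qform (?h P) x" by (intro tendsto_intros t1)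
    then show ?thesis using tendsto_le[OF _ LIMSEQ_Suc[OF lim] _ ev] by simp
  qed
  then have "qform (?h P) x = qform P x" for x using ge by (rule antisym)
  then have "?h P = P"
    by (rule symmetric_eq_if_qform_eq[OF pos_def_sym[OF riccati_map_pos_def[OF PP pos]] P(1)])
  then show thesis using that PP by blast
qed

section \<open>The filter\<close>

lemma diff_matrix_mult: "(A - B) ** C = A ** C - B ** C"
  for A B :: "real ^ 'm::finite ^ 'k::finite"
  by (simp add: vec_eq_iff matrix_matrix_mult_def left_diff_distrib sum_subtractf)

lemma filter_eq_riccati_iterates:
  assumes "block_diag_filter F Q H R Pm K Pp"
  shows "Pm (Suc k) = (riccati_map F Q H R ^^ k) (Pm 1)"
proof (induction k)
  case (Suc k)
  note f = assms[unfolded block_diag_filter_def, rule_format]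
  have "Pm (Suc (Suc k)) = F ** Pp (Suc k) ** transpose F + Q"
    using f[of "Suc (Suc k)"] by simp
  moreover have "Pp (Suc k) = block_diag_proj ((mat 1 - K (Suc k) ** H) ** Pm (Suc k))"
    and "K (Suc k) = Pm (Suc k) ** transpose H ** matrix_inv (H ** Pm (Suc k) ** transpose H + R)"
    using f[of "Suc k"] by auto
  ultimately have "Pm (Suc (Suc k)) = riccati_map F Q H R (Pm (Suc k))"
    by (simp add: riccati_map_def posterior_def diff_matrix_mult)
  then show ?case using Suc by simp
qed simp

theorem proposition2p1:
  fixes F Q :: "real ^ ('n::finite \<times> 'c::finite) ^ ('n \<times> 'c)"
    and H :: "real ^ ('n \<times> 'c) ^ ('n \<times> 'd::finite)"
    and R :: "real ^ ('n \<times> 'd) ^ ('n \<times> 'd)"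
    and Fb :: "'n \<Rightarrow> real ^ 'c ^ 'c"
    and Hb :: "'n \<Rightarrow> real ^ 'c ^ 'd"
    and Rb :: "'n \<Rightarrow> real ^ 'd ^ 'd"
  assumes "F = block_diag Fb"
    and "H = block_diag Hb"
    and "R = block_diag Rb"
    and "pos_def R"
    and "transpose Q = Q"
    and "detectable F H"
    and "pos_def Q"
  shows "\<exists>P. pos_def P \<and> steady_state F Q H R P \<and>
             (\<forall>P'. pos_def P' \<and> steady_state F Q H R P' \<longrightarrow> P' = P) \<and>
             (\<forall>Pm K Pp. pos_def (Pp 0) \<and> block_diag_filter F Q H R Pm K Pp \<longrightarrow> Pm \<longlonglongrightarrow> P)"
proof -
  let ?h = "riccati_map F Q H R"
  have steady: "steady_state F Q H R P \<longleftrightarrow> ?h P = P" for P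
    unfolding steady_state_def riccati_map_def posterior_def by (rule eq_commute)
  obtain P where P: "pos_def P" "?h P = P"
    using riccati_fixed_point_exists[OF assms(1,2,3,4,7,6)] by blast
  have conv: "(\<lambda>k. (?h ^^ k) X) \<longlonglongrightarrow> P" if "pos_def X" for X
    using riccati_iterates_tendsto_fixed_point[OF P assms(4,7) that] .
  have "P' = P" if "pos_def P'" "?h P' = P'" for P'
  proof -
    have "(?h ^^ k) P' = P'" for k by (induction k) (simp_all add: that(2))
    then show ?thesis using conv[OF that(1)] by (simp add: LIMSEQ_const_iff)
  qed
  moreover have "Pm \<longlonglongrightarrow> P" if "pos_def (Pp 0)" and f: "block_diag_filter F Q H R Pm K Pp" for Pm K Pp
  proof -
    have Pm1: "Pm 1 = F ** Pp 0 ** transpose F + Q"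
      using f[unfolded block_diag_filter_def, rule_format, of 1] by simp
    have "pos_def (Pm 1)"
    proof (rule pos_defI)
      show "transpose (Pm 1) = Pm 1"
        unfolding Pm1 transpose_add assms(5) symmetric_congruence[OF pos_def_sym[OF that(1)]] ..
      show "0 < qform (Pm 1) x" if "x \<noteq> 0" for x
        unfolding Pm1 qform_add qform_congruence
        using pos_def_qform_nonneg[OF \<open>pos_def (Pp 0)\<close>] pos_def_qform_pos[OF assms(7) that]
        by (rule add_nonneg_pos)
    qed
    from conv[OF this] show ?thesis
      unfolding filter_eq_riccati_iterates[OF f, symmetric] by (rule LIMSEQ_imp_Suc)
  qed
  ultimately show ?thesis using P unfolding steady by blast
qed

end
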